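(* Let $n,d,r$ (with $1\le r\le d$) and $\alpha^*>0$ be given and let $\mathscr{K}(r,\alpha^* )=\{\Theta\in\mathbb{R}^{d\times d}:\mathrm{rank}(\Theta)\le r,\ \|\Theta\|_{\max}\le\alpha^*\}$. For an underlying $\Theta\in\mathscr{K}(r,\alpha^* )$ suppose the data $(\mathbf{X}_k,\dot Y_k)_{k=1}^n$ are generated as follows: $\mathbf{X}_1,\dots,\mathbf{X}_n$ are i.i.d. uniform on $\{e_ie_j^T:i,j\in[d]\}$, $Y_k=\langle\mathbf{X}_k,\Theta\rangle+\epsilon_k$ with $\mathbb{E}\epsilon_k=0$, $\mathbb{E}|\epsilon_k|^2\le M$, $\widetilde Y_k=\mathrm{sign}(Y_k)\min\{|Y_k|,\eta\}$, and $\dot Y_k=\mathrm{sign}(\widetilde Y_k+\Lambda_k)$ with $\Lambda_k\sim\mathrm{uniform}([-\gamma,\gamma])$, where $$\eta=C_{15}\max\{\alpha^*,\sqrt M\}\Big(\frac{n}{\delta d\log d}\Big)^{1/4},\qquad \gamma=C_{16}\max\{\alpha^*,\sqrt M\}\Big(\frac{n}{\delta d\log d}\Big)^{1/4},$$ $C_{16}>C_{15}$, $\gamma>2\max\{\alpha^*,\sqrt M\}$, and assume $\gamma>\eta>\alpha^*$. Consider any algorithm which, for any underlying $\Theta\in\mathscr{K}(r,\alpha^* )$, takes the corresponding $(\mathbf{X}_k,\dot Y_k)_{k=1}^n$ as input and returns $\widehat\Theta$. Then for some absolute constants $D_1,D_2>0$ there exists $\Theta_0\in\mathscr{K}(r,\alpha^*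 )$ such that, when $\Theta_0$ is the underlying matrix, with probability at least $\frac34$, $$\frac{\|\widehat\Theta-\Theta_0\|_{\mathrm F}^2}{d^2}\ge\min\Big\{D_1(\alpha^* )^2,\ D_2\big((\alpha^* )^2+M\big)r\sqrt{\frac{d}{n\log d}}\Big\}.$$
   Context: $[d]=\{1,\dots,d\}$, $d\ge2$; $e_i$ is the $i$-th standard basis vector of $\mathbb{R}^d$; $\langle A,B\rangle=\mathrm{Tr}(A^TB)$; $\|\cdot\|_{\mathrm F}$ is the Frobenius norm and $\|\cdot\|_{\max}$ the largest absolute entry. $\mathrm{sign}(x)=1$ if $x\ge0$, $-1$ if $x<0$. The noises $\epsilon_k$ are i.i.d., independent of the $\mathbf{X}_k$, with distribution not depending on $\Theta$ (they may be identically zero); the dithers $\Lambda_k$ are i.i.d. and independent of all $(\mathbf{X}_k,\epsilon_k)$. The parameters $\delta>1$, $C_{15}$, $C_{16}$ are regarded as fixed constants, and "absolute constants" $D_1,D_2$ may depend on them but on nothing else. *)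

theory Defs
  imports "HOL-Probability.Probability" "Jordan_Normal_Form.DL_Rank"
begin

text \<open>
  The dimension \<open>d\<close> is quantified inside the theorem, so \<open>d \<times> d\<close> matrices are elements of
  \<^term>\<open>carrier_mat d d\<close>, with indices running over \<open>{0..<d}\<close>.
\<close>

definition mat_trace :: "real mat \<Rightarrow> real" where
  "mat_trace A = (\<Sum>i<dim_row A. A $$ (i, i))"

definition mat_inner :: "real mat \<Rightarrow> real mat \<Rightarrow> real" where
  "mat_inner A B = mat_trace (transpose_mat A * B)"

definition frob_norm :: "real mat \<Rightarrow> real" where
  "frob_norm A = sqrt (\<Sum>i<dim_row A. \<Sum>j<dim_col A. (A $$ (i, j))\<^sup>2)"

definition max_norm :: "real mat \<Rightarrow> real" where
  "max_norm A = Max (abs ` elements_mat A)"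

definition matrix_unit :: "nat \<Rightarrow> nat \<Rightarrow> nat \<Rightarrow> real mat" where
  "matrix_unit d i j = mat_of_cols d [unit_vec d i] * transpose_mat (mat_of_cols d [unit_vec d j])"

definition matrix_units :: "nat \<Rightarrow> real mat set" where
  "matrix_units d = {matrix_unit d i j |i j. i < d \<and> j < d}"

definition low_rank_class :: "nat \<Rightarrow> nat \<Rightarrow> real \<Rightarrow> real mat set" where
  "low_rank_class d r \<alpha> = {\<Theta> \<in> carrier_mat d d. vec_space.rank d \<Theta> \<le> r \<and> max_norm \<Theta> \<le> \<alpha>}"

text \<open>In contrast to the library's \<^const>\<open>sgn\<close>, the sign of \<open>0\<close> is \<open>1\<close>.\<close>

definition sign1 :: "real \<Rightarrow> real" where
  "sign1 x = (if x \<ge> 0 then 1 else -1)"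

definition truncate_at :: "real \<Rightarrow> real \<Rightarrow> real" where
  "truncate_at \<eta> y = sign1 y * min \<bar>y\<bar> \<eta>"

definition noise_law :: "real \<Rightarrow> real measure \<Rightarrow> bool" where
  "noise_law M N \<longleftrightarrow> prob_space N \<and> sets N = sets borel \<and>
     integrable N (\<lambda>x. x) \<and> (\<integral>x. x \<partial>N) = 0 \<and>
     integrable N (\<lambda>x. x\<^sup>2) \<and> (\<integral>x. x\<^sup>2 \<partial>N) \<le> M"

text \<open>
  The joint law of the triples \<open>(X\<^sub>k, \<epsilon>\<^sub>k, \<Lambda>\<^sub>k)\<close>, \<open>k < n\<close>: these are i.i.d., and the three
  components of each are independent. The underlying matrix plays no role here; it only enters
  through the deterministic map \<open>observed_data\<close> below.
\<close>

definition sampling_law ::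
  "nat \<Rightarrow> nat \<Rightarrow> real measure \<Rightarrow> real \<Rightarrow> (nat \<Rightarrow> real mat \<times> real \<times> real) measure" where
  "sampling_law n d N \<gamma> =
     (\<Pi>\<^sub>M k\<in>{..<n}. uniform_count_measure (matrix_units d) \<Otimes>\<^sub>M
                    (N \<Otimes>\<^sub>M uniform_measure lborel {-\<gamma>..\<gamma>}))"

definition one_bit_obs :: "real \<Rightarrow> real mat \<Rightarrow> real mat \<times> real \<times> real \<Rightarrow> real" where
  "one_bit_obs \<eta> \<Theta> = (\<lambda>(X, \<epsilon>, \<Lambda>). sign1 (truncate_at \<eta> (mat_inner X \<Theta> + \<epsilon>) + \<Lambda>))"

definition observed_data ::
  "nat \<Rightarrow> real \<Rightarrow> real mat \<Rightarrow> (nat \<Rightarrow> real mat \<times> real \<times> real) \<Rightarrow> (real mat \<times> real) list" where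
  "observed_data n \<eta> \<Theta> \<omega> = map (\<lambda>k. (fst (\<omega> k), one_bit_obs \<eta> \<Theta> (\<omega> k))) [0..<n]"

text \<open>
  An algorithm maps the data and a random seed with law \<open>S\<close>, drawn independently of the data, to a
  \<open>d \<times> d\<close> matrix; deterministic algorithms are those ignoring the seed. Since there are only
  finitely many possible data sets, measurability is only needed in the seed, and real seeds
  realize every randomized estimator.
\<close>

definition estimator ::
  "nat \<Rightarrow> real measure \<Rightarrow> ((real mat \<times> real) list \<Rightarrow> real \<Rightarrow> real mat) \<Rightarrow> bool" where
  "estimator d S A \<longleftrightarrow> prob_space S \<and>
     (\<forall>D. (\<forall>s\<in>space S. A D s \<in> carrier_mat d d) \<and>
          (\<forall>i<d. \<forall>j<d. (\<lambda>s. A D s $$ (i, j)) \<in> borel_measurable S))"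

end

theory Submission
  imports Defs
begin

text \<open>
  Put a prior on the class: partition the columns into blocks of width \<open>r\<close>, fill the first block
  with independent entries, uniform on 128 equally spaced levels between \<open>0\<close> and \<open>h\<close>, and repeat
  it along the columns. Such a matrix has at most \<open>r\<close> distinct columns. For a fixed output of
  the algorithm, a Chernoff bound shows that the set of matrices within squared Frobenius distance of order
  \<open>h\<^sup>2 d\<^sup>2\<close> has prior mass at most \<open>1/32\<close> to the power \<open>r d\<close>.

  Dithering makes the law of one bit affine in the truncated mean: \<open>y \<in> {-1, 1}\<close> has probability
  \<open>(1 + y E[truncate \<eta> (\<theta> + \<epsilon>)] / \<gamma>) / 2\<close>. As \<open>\<eta> / \<gamma> = C15 / C16 < 1\<close>, replacing \<open>\<Theta>\<close> by \<open>0\<close>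
  costs a chi-square divergence \<open>O(h\<^sup>2 / \<gamma>\<^sup>2)\<close> per sample, hence a likelihood ratio with second moment at
  most \<open>exp (O(n h\<^sup>2 / \<gamma>\<^sup>2))\<close>. With \<open>h\<^sup>2\<close> of order \<open>r d \<gamma>\<^sup>2 / n\<close>, capped at \<open>\<alpha>\<^sup>2\<close>, this factor
  does not compensate the small prior mass. Using many levels instead of signs keeps the failure
  probability above \<open>3/4\<close> even for bounded \<open>r d\<close>, where Fano's inequality over sign matrices gives
  nothing.
\<close>

subsection \<open>Small balls and change of measure\<close>

lemma card_near_int_le_1:
  fixes t :: real
  shows "card {s\<in>{..<K::nat}. \<bar>real s - t\<bar> < 1/2} \<le> 1"
proof -
  have "a = b" if "a \<in> {s\<in>{..<K}. \<bar>real s - t\<bar> < 1/2}" "b \<in> {s\<in>{..<K}. \<bar>real s - t\<bar> < 1/2}" for a b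
  proof -
    have "\<bar>real a - t\<bar> < 1/2" "\<bar>real b - t\<bar> < 1/2" using that by auto
    then show ?thesis by linarith
  qed
  then show ?thesis by (auto simp: card_le_Suc0_iff_eq)
qed

text \<open>The rate 28 gives each level at distance at least \<open>1/2\<close> a weight of at most \<open>2 powr (-7) = 1/128\<close>.\<close>

lemma sum_gaussian_levels_le:
  fixes t :: real
  shows "(\<Sum>s<128::nat. 2 powr (- 28 * (real s - t)\<^sup>2)) \<le> 2"
proof -
  let ?N = "{s\<in>{..<128::nat}. \<bar>real s - t\<bar> < 1/2}"
  have "(\<Sum>s<128::nat. 2 powr (- 28 * (real s - t)\<^sup>2))
      \<le> (\<Sum>s<128::nat. (if s \<in> ?N then 1 else 0) + 1/128)"
  proof (rule sum_mono)
    fix s :: nat assume "s \<in> {..<128}"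
    show "2 powr (- 28 * (real s - t)\<^sup>2) \<le> (if s \<in> ?N then 1 else 0) + (1/128::real)"
    proof (cases "s \<in> ?N")
      case True
      have "2 powr (- 28 * (real s - t)\<^sup>2) \<le> (2::real) powr 0"
        by (rule powr_mono) auto
      then show ?thesis using True by simp
    next
      case False
      then have "1/2 \<le> \<bar>real s - t\<bar>" using \<open>s \<in> {..<128}\<close> by auto
      then have "(1/2)\<^sup>2 \<le> \<bar>real s - t\<bar>\<^sup>2" by (rule power_mono) simp
      then have "2 powr (- 28 * (real s - t)\<^sup>2) \<le> (2::real) powr (- 7)"
        by (intro powr_mono) (auto simp: power2_eq_square)
      also have "\<dots> = 1/128" by (simp add: powr_minus powr_numeral)
      finally show ?thesis using False by simp
    qed
  qed
  also have "\<dots> = real (card ?N) + 1"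
    by (simp add: sum.distrib sum.If_cases Int_def)
  also have "\<dots> \<le> 2" using card_near_int_le_1[of "128" t] by simp
  finally show ?thesis .
qed

text \<open>Chernoff bound: the indicator of the ball is at most \<open>2\<close> to the power
  \<open>card J\<close> minus \<open>28\<close> times the squared distance, and this weight factors
  over \<open>J\<close>. Each factor sums to at most \<open>2\<close> over the levels; the offset
  \<open>card J\<close>, which makes the exponent nonnegative up to the radius
  \<open>card J / 28\<close>, costs the other \<open>2 ^ card J\<close>.\<close>

lemma card_near_levels_le:
  fixes t :: "'j \<Rightarrow> real"
  assumes "finite J"
  shows "card {s \<in> J \<rightarrow>\<^sub>E {..<128::nat}. (\<Sum>j\<in>J. (real (s j) - t j)\<^sup>2) \<le> card J / 28} \<le> 4 ^ card J"
proof -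
  let ?S = "J \<rightarrow>\<^sub>E {..<128::nat}"
  let ?P = "\<lambda>s. (\<Sum>j\<in>J. (real (s j) - t j)\<^sup>2) \<le> card J / 28"
  have fin: "finite ?S" using assms by (auto intro: finite_PiE)
  have "real (card {s\<in>?S. ?P s}) = (\<Sum>s\<in>?S. if ?P s then 1 else 0)"
    using fin by (simp add: sum.If_cases Int_def)
  also have "\<dots> \<le> (\<Sum>s\<in>?S. 2 ^ card J * (\<Prod>j\<in>J. 2 powr (- 28 * (real (s j) - t j)\<^sup>2)))"
  proof (rule sum_mono)
    fix s assume "s \<in> ?S"
    have *: "2 ^ card J * (\<Prod>j\<in>J. 2 powr (- 28 * (real (s j) - t j)\<^sup>2))
        = (2::real) powr (card J - 28 * (\<Sum>j\<in>J. (real (s j) - t j)\<^sup>2))"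
      unfolding diff_conv_add_uminus powr_add
      using powr_sum[of "2::real" "\<lambda>j. - 28 * (real (s j) - t j)\<^sup>2" J] assms
      by (simp add: powr_realpow sum_distrib_left sum_negf)
    show "(if ?P s then 1 else 0) \<le> 2 ^ card J * (\<Prod>j\<in>J. 2 powr (- 28 * (real (s j) - t j)\<^sup>2))"
      unfolding * by (auto intro!: ge_one_powr_ge_zero)
  qed
  also have "\<dots> = 2 ^ card J * (\<Prod>j\<in>J. \<Sum>s<128::nat. 2 powr (- 28 * (real s - t j)\<^sup>2))"
    using assms by (simp add: sum_distrib_left[symmetric] prod_sum_PiE)
  also have "\<dots> \<le> 2 ^ card J * (\<Prod>j\<in>J. 2)"
    by (intro mult_left_mono prod_mono conjI sum_nonneg sum_gaussian_levels_le) auto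
  also have "\<dots> = 4 ^ card J"
    by (simp flip: power_mult_distrib)
  finally have "real (card {s\<in>?S. ?P s}) \<le> real (4 ^ card J)" by simp
  then show ?thesis unfolding of_nat_le_iff .
qed

text \<open>
  The change of measure from \<open>P i\<close> to the reference \<open>Q\<close>, averaged over \<open>i\<close>. AM-GM with the free
  weight \<open>B\<close> takes the place of Cauchy-Schwarz.
\<close>

lemma sum_success_le:
  fixes P f :: "'i \<Rightarrow> 'x \<Rightarrow> real" and Q :: "'x \<Rightarrow> real" and B V W :: real
  assumes "B > 0"
    and Q_pos: "\<And>x. x \<in> X \<Longrightarrow> Q x > 0" and Q_sum: "(\<Sum>x\<in>X. Q x) = 1"
    and f_nonneg: "\<And>i x. i \<in> I \<Longrightarrow> x \<in> X \<Longrightarrow> f i x \<ge> 0"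
    and f_le_1: "\<And>i x. i \<in> I \<Longrightarrow> x \<in> X \<Longrightarrow> f i x \<le> 1"
    and chi2: "\<And>i. i \<in> I \<Longrightarrow> (\<Sum>x\<in>X. (P i x)\<^sup>2 / Q x) \<le> V"
    and small: "\<And>x. x \<in> X \<Longrightarrow> (\<Sum>i\<in>I. f i x) \<le> W"
  shows "(\<Sum>i\<in>I. \<Sum>x\<in>X. P i x * f i x) \<le> (B * W + card I * V / B) / 2"
proof -
  have pt: "P i x * f i x \<le> (B * (Q x * f i x) + (P i x)\<^sup>2 / Q x / B) / 2"
    if "i \<in> I" "x \<in> X" for i x
  proof -
    \<comment> \<open>Scaling by \<open>?u\<close> and its inverse makes
      \<open>P i x * f i x\<close> the cross term of a square.\<close>
    let ?u = "sqrt (B * Q x)"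
    have pos: "B * Q x > 0" using assms(1) Q_pos that by simp
    have u: "?u > 0" "?u\<^sup>2 = B * Q x" using pos by auto
    have "0 \<le> (?u * f i x - P i x / ?u)\<^sup>2" by simp
    also have "\<dots> = ?u\<^sup>2 * (f i x)\<^sup>2 + (P i x)\<^sup>2 / ?u\<^sup>2 - 2 * (P i x * f i x)"
    proof -
      have "(v * b - a / v)\<^sup>2 = v\<^sup>2 * b\<^sup>2 + a\<^sup>2 / v\<^sup>2 - 2 * (a * b)" if "v > 0" for v a b :: real
        using that by (simp add: power2_diff power_mult_distrib power_divide)
      from this[OF u(1)] show ?thesis .
    qed
    also have "\<dots> = B * Q x * (f i x)\<^sup>2 + (P i x)\<^sup>2 / (B * Q x) - 2 * (P i x * f i x)"
      using u(2) by simp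
    finally have *: "2 * (P i x * f i x) \<le> B * Q x * (f i x)\<^sup>2 + (P i x)\<^sup>2 / (B * Q x)" by simp
    \<comment> \<open>As \<open>f\<close> takes values in \<open>[0, 1]\<close>, dropping the square
      leaves a bound linear in \<open>f\<close>, to which \<open>small\<close> applies once the two
      sums are exchanged.\<close>
    have "(f i x)\<^sup>2 \<le> f i x"
      using f_nonneg[OF that] f_le_1[OF that] by (simp add: power2_eq_square mult_left_le)
    then have "B * Q x * (f i x)\<^sup>2 \<le> B * Q x * f i x"
      using pos by (intro mult_left_mono) auto
    with * show ?thesis by (simp add: ac_simps)
  qed
  have "(\<Sum>i\<in>I. \<Sum>x\<in>X. P i x * f i x)
      \<le> (\<Sum>i\<in>I. \<Sum>x\<in>X. (B * (Q x * f i x) + (P i x)\<^sup>2 / Q x / B) / 2)"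
    by (intro sum_mono pt)
  also have "\<dots> = (B * (\<Sum>i\<in>I. \<Sum>x\<in>X. Q x * f i x) + (\<Sum>i\<in>I. \<Sum>x\<in>X. (P i x)\<^sup>2 / Q x) / B) / 2"
    by (simp add: sum.distrib sum_distrib_left sum_divide_distrib add_divide_distrib)
  also have "(\<Sum>i\<in>I. \<Sum>x\<in>X. Q x * f i x) = (\<Sum>x\<in>X. Q x * (\<Sum>i\<in>I. f i x))"
    by (subst sum.swap) (simp add: sum_distrib_left)
  also have "(B * (\<Sum>x\<in>X. Q x * (\<Sum>i\<in>I. f i x)) + (\<Sum>i\<in>I. \<Sum>x\<in>X. (P i x)\<^sup>2 / Q x) / B) / 2
      \<le> (B * (\<Sum>x\<in>X. Q x * W) + (\<Sum>i\<in>I. V) / B) / 2"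
    using \<open>B > 0\<close>
    by (intro divide_right_mono add_mono mult_left_mono sum_mono chi2 small)
       (auto intro: less_imp_le[OF Q_pos])
  also have "\<dots> = (B * W + card I * V / B) / 2"
    by (simp add: sum_distrib_right[symmetric] Q_sum)
  finally show ?thesis .
qed

text \<open>Tensorization of the second moment of a likelihood ratio (one plus the chi-square
  divergence): square and quotient pass inside the product over samples, and the sum over data sets
  then factors.\<close>

lemma sum_PiE_chi_square:
  fixes p q :: "'x \<Rightarrow> real"
  assumes "finite X"
  shows "(\<Sum>D\<in>{..<n::nat} \<rightarrow>\<^sub>E X. (\<Prod>k<n. p (D k))\<^sup>2 / (\<Prod>k<n. q (D k))) = (\<Sum>x\<in>X. (p x)\<^sup>2 / q x) ^ n"
proof -
  have "(\<Sum>D\<in>{..<n} \<rightarrow>\<^sub>E X. (\<Prod>k<n. p (D k))\<^sup>2 / (\<Prod>k<n. q (D k)))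
      = (\<Sum>D\<in>{..<n} \<rightarrow>\<^sub>E X. \<Prod>k<n. (p (D k))\<^sup>2 / q (D k))"
    by (simp add: prod_power_distrib prod_dividef)
  also have "\<dots> = (\<Prod>k<n. \<Sum>x\<in>X. (p x)\<^sup>2 / q x)"
    using assms by (subst prod_sum_PiE) auto
  finally show ?thesis by simp
qed

lemma sum_PiE_prod_eq_1:
  fixes p :: "'x \<Rightarrow> real"
  assumes "finite X" "(\<Sum>x\<in>X. p x) = 1"
  shows "(\<Sum>D\<in>{..<n::nat} \<rightarrow>\<^sub>E X. \<Prod>k<n. p (D k)) = 1"
  using prod_sum_PiE[of "{..<n}" "\<lambda>_. X" "\<lambda>_. p"] assms by simp

text \<open>For \<open>\<bar>u\<bar> \<le> 1\<close> this is one plus the chi-square divergence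
  between the laws on \<open>{-1, 1}\<close> with means \<open>u\<close> and \<open>v\<close>; the
  denominator on the right is the variance of the reference law.\<close>

lemma sum_two_point_chi_square:
  fixes u v :: real
  assumes "\<bar>v\<bar> < 1"
  shows "(\<Sum>y\<in>{-1,1}. ((1 + y * u) / 2)\<^sup>2 / ((1 + y * v) / 2)) = 1 + (u - v)\<^sup>2 / (1 - v\<^sup>2)"
proof -
  have *: "1 + v \<noteq> 0" "1 - v \<noteq> 0" using assms by auto
  have **: "1 - v\<^sup>2 = (1 + v) * (1 - v)" by (simp add: power2_eq_square algebra_simps)
  have "1 - v\<^sup>2 \<noteq> 0" unfolding ** using * by simp
  have "(\<Sum>y\<in>{-1,1}. ((1 + y * u) / 2)\<^sup>2 / ((1 + y * v) / 2))
     = (1 - u)\<^sup>2 / (2 * (1 - v)) + (1 + u)\<^sup>2 / (2 * (1 + v))"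
    by (simp add: power2_eq_square)
  also have "\<dots> = 1 + (u - v)\<^sup>2 / ((1 + v) * (1 - v))"
  proof -
    have "(1 - u)\<^sup>2 / (2 * b) + (1 + u)\<^sup>2 / (2 * a) = ((1 - u)\<^sup>2 * a + (1 + u)\<^sup>2 * b) / (2 * (a * b))"
      if "a \<noteq> 0" "b \<noteq> 0" for a b :: real
      using that by (simp add: field_simps)
    then have "(1 - u)\<^sup>2 / (2 * (1 - v)) + (1 + u)\<^sup>2 / (2 * (1 + v))
        = ((1 - u)\<^sup>2 * (1 + v) + (1 + u)\<^sup>2 * (1 - v)) / (2 * ((1 + v) * (1 - v)))"
      using * by blast
    also have "(1 - u)\<^sup>2 * (1 + v) + (1 + u)\<^sup>2 * (1 - v) = 2 * ((1 + v) * (1 - v) + (u - v)\<^sup>2)"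
      by (simp add: power2_eq_square algebra_simps)
    finally show ?thesis using * by (simp add: add_divide_distrib)
  qed
  finally show ?thesis by (simp add: **)
qed

subsection \<open>Laws of product observations and of dithered bits\<close>

text \<open>Turns a probability over continuous noise into a finite sum: as \<open>obs\<close> takes
  finitely many values, the event is a disjoint union of rectangles, one per data set
  \<open>D\<close>, and each has product measure. Restricting the data to \<open>{..<n}\<close> puts
  them into the extensional function space, where agreement on \<open>{..<n}\<close> is
  equality.\<close>

lemma measure_observations_pair:
  fixes obs :: "'z \<Rightarrow> 'x" and G :: "(nat \<Rightarrow> 'x) \<Rightarrow> 's set"
  assumes M: "prob_space M" and S: "prob_space S" and X: "finite X"
    and obs: "\<And>z. z \<in> space M \<Longrightarrow> obs z \<in> X"
    and meas: "\<And>x. x \<in> X \<Longrightarrow> {z\<in>space M. obs z = x} \<in> sets M"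
    and G: "\<And>D. D \<in> {..<n} \<rightarrow>\<^sub>E X \<Longrightarrow> G D \<in> sets S"
  shows "measure ((\<Pi>\<^sub>M k\<in>{..<n}. M) \<Otimes>\<^sub>M S)
      {(\<omega>, s) \<in> space ((\<Pi>\<^sub>M k\<in>{..<n}. M) \<Otimes>\<^sub>M S). s \<in> G (\<lambda>k\<in>{..<n}. obs (\<omega> k))}
    = (\<Sum>D\<in>{..<n} \<rightarrow>\<^sub>E X. (\<Prod>k<n. measure M {z\<in>space M. obs z = D k}) * measure S (G D))"
proof -
  interpret M: prob_space M by fact
  interpret S: prob_space S by fact
  interpret Pi: product_prob_space "\<lambda>_::nat. M" "{..<n}" by unfold_locales
  interpret Pi: prob_space "\<Pi>\<^sub>M k\<in>{..<n}. M" by (rule Pi.prob_space_axioms)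
  interpret Pair: pair_prob_space "\<Pi>\<^sub>M k\<in>{..<n}. M" S by unfold_locales
  let ?E = "\<lambda>D. (\<Pi>\<^sub>E k\<in>{..<n}. {z\<in>space M. obs z = D k})"
  have sets: "?E D \<in> sets (\<Pi>\<^sub>M k\<in>{..<n}. M)" if "D \<in> {..<n} \<rightarrow>\<^sub>E X" for D
    using that by (intro sets_PiM_I_finite) (auto intro!: meas)
  have eq: "{(\<omega>, s) \<in> space ((\<Pi>\<^sub>M k\<in>{..<n}. M) \<Otimes>\<^sub>M S). s \<in> G (\<lambda>k\<in>{..<n}. obs (\<omega> k))}
     = (\<Union>D\<in>{..<n} \<rightarrow>\<^sub>E X. ?E D \<times> G D)" (is "?L = ?R")
  proof (intro equalityI subsetI)
    fix w assume "w \<in> ?L"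
    then obtain \<omega> s where w: "w = (\<omega>, s)" "\<omega> \<in> {..<n} \<rightarrow>\<^sub>E space M" "s \<in> G (\<lambda>k\<in>{..<n}. obs (\<omega> k))"
      by (auto simp: space_pair_measure space_PiM)
    have "(\<lambda>k\<in>{..<n}. obs (\<omega> k)) \<in> {..<n} \<rightarrow>\<^sub>E X" using w(2) by (auto intro!: obs)
    moreover have "\<omega> \<in> ?E (\<lambda>k\<in>{..<n}. obs (\<omega> k))" using w(2) by (auto simp: PiE_iff)
    ultimately show "w \<in> ?R" using w by blast
  next
    fix w assume "w \<in> ?R"
    then obtain D \<omega> s where w: "w = (\<omega>, s)" "D \<in> {..<n} \<rightarrow>\<^sub>E X" "\<omega> \<in> ?E D" "s \<in> G D" by blast
    have "(\<lambda>k\<in>{..<n}. obs (\<omega> k)) = D"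
      using w(2,3) by (auto simp: fun_eq_iff PiE_iff extensional_def)
    moreover have "s \<in> space S" using G[OF w(2)] w(4) sets.sets_into_space by blast
    ultimately show "w \<in> ?L"
      using w by (auto simp: space_pair_measure space_PiM PiE_iff)
  qed
  have disj: "disjoint_family_on (\<lambda>D. ?E D \<times> G D) ({..<n} \<rightarrow>\<^sub>E X)"
    unfolding disjoint_family_on_def
  proof (intro ballI impI)
    fix D D' assume D: "D \<in> {..<n} \<rightarrow>\<^sub>E X" "D' \<in> {..<n} \<rightarrow>\<^sub>E X" "D \<noteq> D'"
    then obtain k where "k < n" "D k \<noteq> D' k" by (metis PiE_ext lessThan_iff)
    then have "?E D \<inter> ?E D' = {}" by (force simp: PiE_iff)
    then show "?E D \<times> G D \<inter> ?E D' \<times> G D' = {}" by blast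
  qed
  have "measure ((\<Pi>\<^sub>M k\<in>{..<n}. M) \<Otimes>\<^sub>M S) (\<Union>D\<in>{..<n} \<rightarrow>\<^sub>E X. ?E D \<times> G D)
     = (\<Sum>D\<in>{..<n} \<rightarrow>\<^sub>E X. measure ((\<Pi>\<^sub>M k\<in>{..<n}. M) \<Otimes>\<^sub>M S) (?E D \<times> G D))"
    using X sets G disj
    by (intro Pair.finite_measure_finite_Union finite_PiE) (auto intro!: pair_measureI)
  also have "\<dots> = (\<Sum>D\<in>{..<n} \<rightarrow>\<^sub>E X. (\<Prod>k<n. measure M {z\<in>space M. obs z = D k}) * measure S (G D))"
  proof (rule sum.cong[OF refl])
    fix D assume D: "D \<in> {..<n} \<rightarrow>\<^sub>E X"
    have "measure (\<Pi>\<^sub>M k\<in>{..<n}. M) (?E D) = (\<Prod>k<n. measure M {z\<in>space M. obs z = D k})"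
    proof -
      interpret F: finite_product_prob_space "\<lambda>_::nat. M" "{..<n}" by unfold_locales simp
      show ?thesis using D by (intro F.prob_times) (auto intro!: meas)
    qed
    moreover have "measure ((\<Pi>\<^sub>M k\<in>{..<n}. M) \<Otimes>\<^sub>M S) (?E D \<times> G D)
        = measure (\<Pi>\<^sub>M k\<in>{..<n}. M) (?E D) * measure S (G D)"
      using S.emeasure_pair_measure_Times[OF sets[OF D] G[OF D]]
      by (simp add: measure_def enn2real_mult)
    ultimately show "measure ((\<Pi>\<^sub>M k\<in>{..<n}. M) \<Otimes>\<^sub>M S) (?E D \<times> G D)
        = (\<Prod>k<n. measure M {z\<in>space M. obs z = D k}) * measure S (G D)" by simp
  qed
  finally show ?thesis unfolding eq .
qed

section \<open>Truncation and its mean under the noise\<close>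

lemma measurable_truncate_at [measurable]: "truncate_at \<eta> \<in> borel_measurable borel"
  unfolding truncate_at_def sign1_def by measurable

text \<open>Truncation is the projection onto \<open>{-\<eta>..\<eta>}\<close>; in this form
  boundedness and the Lipschitz property are case splits.\<close>

lemma truncate_at_eq_clamp: "\<eta> \<ge> 0 \<Longrightarrow> truncate_at \<eta> y = max (- \<eta>) (min y \<eta>)"
  unfolding truncate_at_def sign1_def by auto

lemma abs_truncate_at_le: "\<eta> \<ge> 0 \<Longrightarrow> \<bar>truncate_at \<eta> y\<bar> \<le> \<eta>"
  by (auto simp: truncate_at_eq_clamp)

lemma truncate_at_lipschitz: "\<eta> \<ge> 0 \<Longrightarrow> \<bar>truncate_at \<eta> x - truncate_at \<eta> y\<bar> \<le> \<bar>x - y\<bar>"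
  by (auto simp: truncate_at_eq_clamp)

text \<open>Divided by \<open>\<gamma>\<close>, this is the expectation of a dithered bit observed
  at an entry \<open>\<theta>\<close>.\<close>

definition truncated_mean :: "real \<Rightarrow> real measure \<Rightarrow> real \<Rightarrow> real" where
  "truncated_mean \<eta> N \<theta> = (\<integral>x. truncate_at \<eta> (\<theta> + x) \<partial>N)"

lemma integrable_truncate_at:
  assumes "prob_space N" "sets N = sets borel" "\<eta> \<ge> 0"
  shows "integrable N (\<lambda>x. truncate_at \<eta> (\<theta> + x))"
proof -
  interpret prob_space N by fact
  note [measurable_cong] = assms(2)
  show ?thesis
    by (rule integrable_const_bound[where B=\<eta>]) (auto simp: abs_truncate_at_le assms)
qed

lemma abs_truncated_mean_le:
  assumes "prob_space N" "sets N = sets borel" "\<eta> \<ge> 0"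
  shows "\<bar>truncated_mean \<eta> N \<theta>\<bar> \<le> \<eta>"
proof -
  interpret prob_space N by fact
  have "\<bar>truncated_mean \<eta> N \<theta>\<bar> \<le> (\<integral>x. \<bar>truncate_at \<eta> (\<theta> + x)\<bar> \<partial>N)"
    unfolding truncated_mean_def by simp
  also have "\<dots> \<le> (\<integral>x. \<eta> \<partial>N)"
    using assms by (intro integral_mono) (auto intro!: integrable_truncate_at integrable_abs abs_truncate_at_le)
  finally show ?thesis by (simp add: prob_space)
qed

text \<open>The same noise enters both integrals, so the Lipschitz property of truncation applies
  pointwise. This bounds the effect of an entry on its bit uniformly over the noise law.\<close>

lemma truncated_mean_lipschitz:
  assumes "prob_space N" "sets N = sets borel" "\<eta> \<ge> 0"
  shows "\<bar>truncated_mean \<eta> N \<theta> - truncated_mean \<eta> N \<theta>'\<bar> \<le> \<bar>\<theta> - \<theta>'\<bar>"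
proof -
  interpret prob_space N by fact
  note int = integrable_truncate_at[OF assms]
  have "truncated_mean \<eta> N \<theta> - truncated_mean \<eta> N \<theta>'
      = (\<integral>x. truncate_at \<eta> (\<theta> + x) - truncate_at \<eta> (\<theta>' + x) \<partial>N)"
    unfolding truncated_mean_def using int by simp
  also have "\<bar>\<dots>\<bar> \<le> (\<integral>x. \<bar>truncate_at \<eta> (\<theta> + x) - truncate_at \<eta> (\<theta>' + x)\<bar> \<partial>N)"
    by simp
  also have "\<dots> \<le> (\<integral>x. \<bar>\<theta> - \<theta>'\<bar> \<partial>N)"
  proof (rule integral_mono)
    show "\<bar>truncate_at \<eta> (\<theta> + x) - truncate_at \<eta> (\<theta>' + x)\<bar> \<le> \<bar>\<theta> - \<theta>'\<bar>" for x
      using truncate_at_lipschitz[OF assms(3), of "\<theta> + x" "\<theta>' + x"] by simp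
  qed (use int in auto)
  finally show ?thesis by (simp add: prob_space)
qed

text \<open>Given the noise, the truncated value \<open>a\<close> has
  \<open>\<bar>a\<bar> \<le> \<eta> < \<gamma>\<close>, so the sign changes at \<open>-a\<close>
  inside the dithering interval and the probability of the bit is affine in \<open>a\<close>.
  Integrating over the noise therefore just replaces \<open>a\<close> by its mean.\<close>

lemma prob_dithered_sign:
  assumes "prob_space N" "sets N = sets borel" "0 \<le> \<eta>" "\<eta> < \<gamma>" "y \<in> {-1, 1}"
  shows "{z \<in> space (N \<Otimes>\<^sub>M uniform_measure lborel {-\<gamma>..\<gamma>}).
        sign1 (truncate_at \<eta> (\<theta> + fst z) + snd z) = y} \<in> sets (N \<Otimes>\<^sub>M uniform_measure lborel {-\<gamma>..\<gamma>})"
      (is "?B \<in> sets ?NU")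
    and "measure (N \<Otimes>\<^sub>M uniform_measure lborel {-\<gamma>..\<gamma>})
      {z \<in> space (N \<Otimes>\<^sub>M uniform_measure lborel {-\<gamma>..\<gamma>}).
        sign1 (truncate_at \<eta> (\<theta> + fst z) + snd z) = y}
      = (1 + y * (truncated_mean \<eta> N \<theta> / \<gamma>)) / 2"
proof -
  let ?U = "uniform_measure lborel {-\<gamma>..\<gamma>}"
  interpret N: prob_space N by fact
  interpret U: prob_space ?U
    using assms by (intro prob_space_uniform_measure) auto
  note [measurable_cong] = assms(2)
  have [measurable]: "sign1 \<in> borel_measurable borel" unfolding sign1_def by measurable
  show B: "?B \<in> sets ?NU" by measurable
  have U: "emeasure ?U {x. sign1 (a + x) = y} = ennreal ((1 + y * a / \<gamma>) / 2)"
    if a: "\<bar>a\<bar> \<le> \<eta>" for a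
  proof -
    have "{x. sign1 (a + x) = y} \<in> sets borel" by measurable
    then have "emeasure ?U {x. sign1 (a + x) = y}
        = emeasure lborel ({-\<gamma>..\<gamma>} \<inter> {x. sign1 (a + x) = y}) / emeasure lborel {-\<gamma>..\<gamma>}"
      by (intro emeasure_uniform_measure) auto
    \<comment> \<open>The endpoint \<open>-a\<close> belongs to the case \<open>y = 1\<close>, since
      \<open>sign1 0 = 1\<close>.\<close>
    also have "{-\<gamma>..\<gamma>} \<inter> {x. sign1 (a + x) = y} = (if y = 1 then {-a..\<gamma>} else {-\<gamma>..<-a})"
      using a assms by (auto simp: sign1_def split: if_splits)
    also have "emeasure lborel \<dots> = ennreal (\<gamma> + y * a)"
      using a assms(3-5) by auto
    also have "ennreal (\<gamma> + y * a) / emeasure lborel {-\<gamma>..\<gamma>} = ennreal ((\<gamma> + y * a) / (2 * \<gamma>))"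
      using a assms(3-5) by (subst emeasure_lborel_Icc) (auto simp: divide_ennreal)
    also have "(\<gamma> + y * a) / (2 * \<gamma>) = (1 + y * a / \<gamma>) / 2"
      using assms(3,4) by (simp add: field_simps)
    finally show ?thesis .
  qed
  have nn: "0 \<le> (1 + y * t / \<gamma>) / 2" if "\<bar>t\<bar> \<le> \<eta>" for t
    using that assms(3-5) by (auto simp: field_simps)
  have int: "integrable N (\<lambda>x. truncate_at \<eta> (\<theta> + x))"
    using assms by (intro integrable_truncate_at)
  have "emeasure ?NU ?B = (\<integral>\<^sup>+x. emeasure ?U (Pair x -` ?B) \<partial>N)"
    by (rule U.emeasure_pair_measure_alt[OF B])
  also have "\<dots> = (\<integral>\<^sup>+x. ennreal ((1 + y * truncate_at \<eta> (\<theta> + x) / \<gamma>) / 2) \<partial>N)"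
  proof (rule nn_integral_cong)
    fix x assume "x \<in> space N"
    then have "Pair x -` ?B = {l. sign1 (truncate_at \<eta> (\<theta> + x) + l) = y}"
      by (auto simp: space_pair_measure)
    then show "emeasure ?U (Pair x -` ?B) = ennreal ((1 + y * truncate_at \<eta> (\<theta> + x) / \<gamma>) / 2)"
      using U[OF abs_truncate_at_le] assms by simp
  qed
  also have "\<dots> = ennreal (\<integral>x. (1 + y * truncate_at \<eta> (\<theta> + x) / \<gamma>) / 2 \<partial>N)"
    using int nn[OF abs_truncate_at_le] assms(3) by (intro nn_integral_eq_integral) auto
  also have "(\<integral>x. (1 + y * truncate_at \<eta> (\<theta> + x) / \<gamma>) / 2 \<partial>N)
      = (1 + y * (truncated_mean \<eta> N \<theta> / \<gamma>)) / 2"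
    using int by (simp add: truncated_mean_def N.prob_space)
  finally have "emeasure ?NU ?B = ennreal ((1 + y * (truncated_mean \<eta> N \<theta> / \<gamma>)) / 2)" .
  moreover have "0 \<le> (1 + y * (truncated_mean \<eta> N \<theta> / \<gamma>)) / 2"
    using nn[OF abs_truncated_mean_le[OF assms(1-3)], of \<theta>] by simp
  ultimately show "measure ?NU ?B = (1 + y * (truncated_mean \<eta> N \<theta> / \<gamma>)) / 2"
    by (simp add: measure_def)
qed

subsection \<open>Matrix units and the law of one observation\<close>

lemma matrix_unit_carrier [simp]: "matrix_unit d i j \<in> carrier_mat d d"
  unfolding matrix_unit_def by (rule mult_carrier_mat[of _ _ 1]) auto

lemma index_matrix_unit:
  assumes "i < d" "j < d" "a < d" "b < d"
  shows "matrix_unit d i j $$ (a, b) = (if a = i \<and> b = j then 1 else 0)"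
  using assms by (auto simp: matrix_unit_def mat_of_cols_def scalar_prod_def unit_vec_def)

lemma mat_inner_matrix_unit:
  assumes "i < d" "j < d" "\<Theta> \<in> carrier_mat d d"
  shows "mat_inner (matrix_unit d i j) \<Theta> = \<Theta> $$ (i, j)"
proof -
  have d: "dim_row (matrix_unit d i j) = d" "dim_col (matrix_unit d i j) = d"
    using matrix_unit_carrier[of d i j] by (auto simp del: matrix_unit_carrier)
  have "mat_inner (matrix_unit d i j) \<Theta> = (\<Sum>b<d. \<Sum>a<d. matrix_unit d i j $$ (a, b) * \<Theta> $$ (a, b))"
    using assms unfolding mat_inner_def mat_trace_def
    by (auto simp: scalar_prod_def d lessThan_atLeast0 intro!: sum.cong)
  also have "\<dots> = (\<Sum>b<d. \<Sum>a<d. if b = j then (if a = i then \<Theta> $$ (a, b) else 0) else 0)"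
    using assms by (intro sum.cong) (auto simp: index_matrix_unit)
  also have "\<dots> = (\<Sum>b<d. if b = j then \<Theta> $$ (i, b) else 0)"
    using assms by (intro sum.cong) (auto simp: sum.delta)
  also have "\<dots> = \<Theta> $$ (i, j)"
    using assms by (simp add: sum.delta)
  finally show ?thesis .
qed

lemma matrix_units_eq_image: "matrix_units d = (\<lambda>(i, j). matrix_unit d i j) ` ({..<d} \<times> {..<d})"
  unfolding matrix_units_def by auto

lemma inj_on_matrix_unit: "inj_on (\<lambda>(i, j). matrix_unit d i j) ({..<d} \<times> {..<d})"
proof (rule inj_onI, clarsimp)
  fix i j i' j' assume *: "i < d" "j < d" "i' < d" "j' < d" "matrix_unit d i j = matrix_unit d i' j'"
  then have "matrix_unit d i' j' $$ (i, j) = 1"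
    by (metis index_matrix_unit)
  with * show "i = i' \<and> j = j'" by (auto simp: index_matrix_unit split: if_splits)
qed

lemma finite_matrix_units [simp]: "finite (matrix_units d)"
  by (simp add: matrix_units_eq_image)

lemma card_matrix_units: "card (matrix_units d) = d\<^sup>2"
  by (simp add: matrix_units_eq_image card_image inj_on_matrix_unit power2_eq_square)

lemma prob_observation:
  assumes N: "prob_space N" "sets N = sets borel" and \<eta>: "0 \<le> \<eta>" "\<eta> < \<gamma>"
    and X: "X \<in> matrix_units d" and y: "y \<in> {-1, 1}"
  defines "L \<equiv> uniform_count_measure (matrix_units d) \<Otimes>\<^sub>M (N \<Otimes>\<^sub>M uniform_measure lborel {-\<gamma>..\<gamma>})"
  shows "{z \<in> space L. (fst z, one_bit_obs \<eta> \<Theta> z) = (X, y)} \<in> sets L"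
    and "measure L {z \<in> space L. (fst z, one_bit_obs \<eta> \<Theta> z) = (X, y)}
      = (1 + y * (truncated_mean \<eta> N (mat_inner X \<Theta>) / \<gamma>)) / 2 / (real d)\<^sup>2"
proof -
  let ?NU = "N \<Otimes>\<^sub>M uniform_measure lborel {-\<gamma>..\<gamma>}"
  let ?C = "uniform_count_measure (matrix_units d)"
  let ?B = "{z \<in> space ?NU. sign1 (truncate_at \<eta> (mat_inner X \<Theta> + fst z) + snd z) = y}"
  interpret N: prob_space N by fact
  interpret U: prob_space "uniform_measure lborel {-\<gamma>..\<gamma>}"
    using \<eta> by (intro prob_space_uniform_measure) auto
  interpret NU: pair_prob_space N "uniform_measure lborel {-\<gamma>..\<gamma>}" by unfold_locales
  interpret NU: prob_space ?NU by unfold_locales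
  note B = prob_dithered_sign[OF N \<eta> y, of "mat_inner X \<Theta>"]
  have eq: "{z \<in> space L. (fst z, one_bit_obs \<eta> \<Theta> z) = (X, y)} = {X} \<times> ?B"
    using X by (auto simp: L_def space_pair_measure space_uniform_count_measure one_bit_obs_def)
  have XC: "{X} \<in> sets ?C" using X by (simp add: sets_uniform_count_measure)
  show "{z \<in> space L. (fst z, one_bit_obs \<eta> \<Theta> z) = (X, y)} \<in> sets L"
    unfolding eq unfolding L_def by (rule pair_measureI[OF XC B(1)])
  have "measure L ({X} \<times> ?B) = measure ?C {X} * measure ?NU ?B"
    using NU.emeasure_pair_measure_Times[OF XC B(1)]
    by (simp add: L_def measure_def enn2real_mult)
  also have "measure ?C {X} = 1 / (real d)\<^sup>2"
    using X by (simp add: measure_uniform_count_measure card_matrix_units)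
  finally show "measure L {z \<in> space L. (fst z, one_bit_obs \<eta> \<Theta> z) = (X, y)}
      = (1 + y * (truncated_mean \<eta> N (mat_inner X \<Theta>) / \<gamma>)) / 2 / (real d)\<^sup>2"
    unfolding eq B(2) by simp
qed

subsection \<open>Tiled matrices\<close>

text \<open>A maximal independent subset of the columns has as many elements as the rank; taking the
  columns as a set counts repeated ones once.\<close>

lemma rank_le_card_cols:
  fixes A :: "real mat"
  assumes "A \<in> carrier_mat n nc"
  shows "vec_space.rank n A \<le> card (set (cols A))"
proof -
  interpret vec_space "TYPE(real)" n .
  obtain U where U: "maximal U (\<lambda>T. T \<subseteq> set (cols A) \<and> lin_indpt T)"
    using maximal_exists[of "\<lambda>T. T \<subseteq> set (cols A) \<and> lin_indpt T" "card (set (cols A))" "{}"]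
    by (meson List.finite_set card_mono empty_iff empty_subsetI finite_lin_indpt2 rev_finite_subset)
  then show ?thesis
    using rank_card_indpt[OF assms U] by (auto simp: maximal_def intro: card_mono)
qed

text \<open>Integer levels \<open>s\<close> keep the prior a counting problem on
  \<open>{..<128}\<close>; the spacing \<open>c\<close> carries the scale. The last copy of the tile
  is cut off when \<open>r\<close> does not divide \<open>d\<close>.\<close>

definition tiled_mat :: "nat \<Rightarrow> nat \<Rightarrow> real \<Rightarrow> (nat \<times> nat \<Rightarrow> nat) \<Rightarrow> real mat" where
  "tiled_mat d r c s = mat d d (\<lambda>(i, j). c * real (s (i, j mod r)))"

lemma tiled_mat_carrier [simp]: "tiled_mat d r c s \<in> carrier_mat d d"
  by (simp add: tiled_mat_def)

lemma tiled_mat_in_low_rank_class: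
  assumes "d > 0" "r > 0" "c \<ge> 0" "\<And>i j. i < d \<Longrightarrow> j < r \<Longrightarrow> c * real (s (i, j)) \<le> \<alpha>"
  shows "tiled_mat d r c s \<in> low_rank_class d r \<alpha>"
proof -
  let ?A = "tiled_mat d r c s"
  have "set (cols ?A) \<subseteq> (\<lambda>a. vec d (\<lambda>i. c * real (s (i, a)))) ` {..<r}"
    using assms(2) by (auto simp: cols_def tiled_mat_def intro!: image_eqI[of _ _ "_ mod r"] eq_vecI)
  then have "card (set (cols ?A)) \<le> card {..<r}"
    by (rule surj_card_le[rotated]) simp
  then have "vec_space.rank d ?A \<le> r"
    using rank_le_card_cols[OF tiled_mat_carrier] by (metis card_lessThan order_trans)
  moreover have "max_norm ?A \<le> \<alpha>"
    unfolding max_norm_def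
  proof (rule Max.boundedI)
    show "finite (abs ` elements_mat ?A)" by (simp add: elements_mat_def)
    \<comment> \<open>\<open>Max\<close> is only meaningful on a nonempty set, hence the need for an
      entry.\<close>
    have "?A $$ (0, 0) \<in> elements_mat ?A" using assms(1) by (intro elements_matI[OF tiled_mat_carrier]) auto
    then show "abs ` elements_mat ?A \<noteq> {}" by blast
    fix x assume "x \<in> abs ` elements_mat ?A"
    then obtain i j where "i < d" "j < d" "x = \<bar>?A $$ (i, j)\<bar>"
      by (auto dest!: elements_matD simp: tiled_mat_def)
    then show "x \<le> \<alpha>"
      using assms by (auto simp: tiled_mat_def abs_mult)
  qed
  ultimately show ?thesis by (simp add: low_rank_class_def)
qed

lemma frob_norm_minus_sq:
  assumes "B \<in> carrier_mat m n"
  shows "(frob_norm (A - B))\<^sup>2 = (\<Sum>i<m. \<Sum>j<n. (A $$ (i, j) - B $$ (i, j))\<^sup>2)"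
proof -
  have "(frob_norm (A - B))\<^sup>2 = (\<Sum>i<m. \<Sum>j<n. ((A - B) $$ (i, j))\<^sup>2)"
    using assms by (auto simp: frob_norm_def sum_nonneg)
  also have "\<dots> = (\<Sum>i<m. \<Sum>j<n. (A $$ (i, j) - B $$ (i, j))\<^sup>2)"
    using assms by (intro sum.cong) auto
  finally show ?thesis .
qed

text \<open>
  By convexity, averaging an estimate over the \<open>q\<close> complete copies of a tile can only help; this
  average is the effective estimate of the entries of the tile, in units of \<open>c\<close>.
\<close>

definition tile_average :: "nat \<Rightarrow> nat \<Rightarrow> real \<Rightarrow> real mat \<Rightarrow> nat \<times> nat \<Rightarrow> real" where
  "tile_average q r c T = (\<lambda>(i, a). (\<Sum>b<q. T $$ (i, b * r + a)) / (real q * c))"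

lemma frob_norm_tiled_ge:
  assumes "c > 0" "q > 0" "q * r \<le> d"
  shows "(frob_norm (T - tiled_mat d r c s))\<^sup>2
    \<ge> c\<^sup>2 * real q * (\<Sum>p\<in>{..<d} \<times> {..<r}. (real (s p) - tile_average q r c T p)\<^sup>2)"
proof -
  let ?t = "tile_average q r c T"
  have row: "(\<Sum>j<d. (T $$ (i, j) - c * real (s (i, j mod r)))\<^sup>2)
     \<ge> (\<Sum>a<r. c\<^sup>2 * real q * (real (s (i, a)) - ?t (i, a))\<^sup>2)" for i
  proof -
    let ?g = "\<lambda>j. (T $$ (i, j) - c * real (s (i, j mod r)))\<^sup>2"
    have "(\<Sum>a<r. c\<^sup>2 * real q * (real (s (i, a)) - ?t (i, a))\<^sup>2) \<le> (\<Sum>a<r. \<Sum>b<q. ?g (b * r + a))"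
    proof (rule sum_mono)
      fix a assume a: "a \<in> {..<r}"
      let ?S = "\<Sum>b<q. T $$ (i, b * r + a) - c * real (s (i, a))"
      have S: "?S = - (real q * c * (real (s (i, a)) - ?t (i, a)))"
        using assms by (simp add: tile_average_def sum_subtractf algebra_simps)
      have "real q * (c\<^sup>2 * real q * (real (s (i, a)) - ?t (i, a))\<^sup>2) = ?S\<^sup>2"
        unfolding S by (simp add: power2_eq_square)
      \<comment> \<open>Cauchy-Schwarz against the constant \<open>1\<close> over the
        \<open>q\<close> copies.\<close>
      also have "\<dots> \<le> (\<Sum>b<q. (T $$ (i, b * r + a) - c * real (s (i, a)))\<^sup>2) * real (card {..<q})"
        by (rule sum_squared_le_sum_of_squares)
      also have "\<dots> = real q * (\<Sum>b<q. ?g (b * r + a))"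
        using a by simp
      finally show "c\<^sup>2 * real q * (real (s (i, a)) - ?t (i, a))\<^sup>2 \<le> (\<Sum>b<q. ?g (b * r + a))"
        using assms(2) by simp
    qed
    also have "\<dots> = (\<Sum>b<q. \<Sum>a<r. ?g (b * r + a))" by (rule sum.swap)
    also have "\<dots> = (\<Sum>b<q. sum ?g {b * r..<b * r + r})"
    proof (rule sum.cong[OF refl])
      fix b
      show "(\<Sum>a<r. ?g (b * r + a)) = sum ?g {b * r..<b * r + r}"
        using sum.shift_bounds_nat_ivl[of ?g 0 "b * r" r]
        by (simp add: add.commute lessThan_atLeast0)
    qed
    also have "\<dots> = sum ?g {..<q * r}" by (rule sum.nat_group)
    \<comment> \<open>The columns of the incomplete copy only add nonnegative error.\<close>
    also have "\<dots> \<le> sum ?g {..<d}" using assms(3) by (intro sum_mono2) auto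
    finally show ?thesis .
  qed
  have "c\<^sup>2 * real q * (\<Sum>p\<in>{..<d} \<times> {..<r}. (real (s p) - ?t p)\<^sup>2)
    = (\<Sum>i<d. \<Sum>a<r. c\<^sup>2 * real q * (real (s (i, a)) - ?t (i, a))\<^sup>2)"
    by (simp add: sum.cartesian_product sum_distrib_left case_prod_unfold)
  also have "\<dots> \<le> (\<Sum>i<d. \<Sum>j<d. (T $$ (i, j) - c * real (s (i, j mod r)))\<^sup>2)"
    by (intro sum_mono row)
  also have "\<dots> = (frob_norm (T - tiled_mat d r c s))\<^sup>2"
    unfolding frob_norm_minus_sq[OF tiled_mat_carrier] by (intro sum.cong) (auto simp: tiled_mat_def)
  finally show ?thesis .
qed

subsection \<open>The minimax lower bound\<close>

text \<open>Here \<open>h\<close> is the range of the levels. Every bit has mean at most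
  \<open>\<kappa>\<close> in absolute value, hence variance at least
  \<open>1 - \<kappa>\<^sup>2\<close>, and \<open>info\<close> caps the exponent of the likelihood
  ratio's second moment at \<open>r d / 2\<close>. In the threshold, \<open>128\<close> is the
  number of levels and \<open>56 = 2 * 28\<close> combines the Chernoff rate with the loss from the
  incomplete tile.\<close>

lemma minimax_lower_bound:
  assumes d: "d \<ge> 2" and r: "1 \<le> r" "r \<le> d"
    and N: "prob_space N" "sets N = sets borel"
    and \<eta>: "0 \<le> \<eta>" "\<eta> \<le> \<kappa> * \<gamma>" and \<kappa>: "\<kappa> < 1" and \<gamma>: "\<gamma> > 0"
    and h: "0 < h" "h \<le> \<alpha>"
    and info: "real n * h\<^sup>2 \<le> \<gamma>\<^sup>2 * (1 - \<kappa>\<^sup>2) * (real r * real d / 2)"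
    and A: "estimator d S A"
  shows "\<exists>\<Theta>0 \<in> low_rank_class d r \<alpha>.
         measure (sampling_law n d N \<gamma> \<Otimes>\<^sub>M S)
           {(\<omega>, s) \<in> space (sampling_law n d N \<gamma> \<Otimes>\<^sub>M S).
              (frob_norm (A (observed_data n \<eta> \<Theta>0 \<omega>) s - \<Theta>0))\<^sup>2 / (real d)\<^sup>2
              \<ge> h\<^sup>2 / (56 * 128\<^sup>2)} \<ge> 3/4"
proof -
  define J where "J = {..<d} \<times> {..<r}"
  define m where "m = card J"
  define I where "I = J \<rightarrow>\<^sub>E {..<128::nat}"
  define c where "c = h / 128"
  define X where "X = matrix_units d \<times> {-1, 1::real}"
  define mean where "mean = (\<lambda>\<Theta> x. truncated_mean \<eta> N (mat_inner x \<Theta>) / \<gamma>)"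
  \<comment> \<open>The bit mean under the zero matrix; \<open>q\<close> is the resulting reference
    law of one observation, \<open>p s\<close> the law under the tiled matrix.\<close>
  define v where "v = truncated_mean \<eta> N 0 / \<gamma>"
  define p where "p = (\<lambda>s (x, y). (1 + y * mean (tiled_mat d r c s) x) / 2 / (real d)\<^sup>2)"
  define q where "q = (\<lambda>(x::real mat, y). (1 + y * v) / 2 / (real d)\<^sup>2)"
  define fails where "fails = (\<lambda>s D \<sigma>. (frob_norm (A (map D [0..<n]) \<sigma> - tiled_mat d r c s))\<^sup>2 / (real d)\<^sup>2
              \<ge> h\<^sup>2 / (56 * 128\<^sup>2))"
  define f where "f = (\<lambda>s D. measure S {\<sigma>\<in>space S. \<not> fails s D \<sigma>})"
  let ?DS = "{..<n} \<rightarrow>\<^sub>E X"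
  let ?L = "uniform_count_measure (matrix_units d) \<Otimes>\<^sub>M (N \<Otimes>\<^sub>M uniform_measure lborel {-\<gamma>..\<gamma>})"

  interpret S: prob_space S using A by (simp add: estimator_def)
  have A_meas [measurable]: "(\<lambda>\<sigma>. A D \<sigma> $$ (i, j)) \<in> borel_measurable S" if "i < d" "j < d" for D i j
    using A that by (simp add: estimator_def)
  have \<eta>\<gamma>: "\<eta> < \<gamma>" using \<eta>(2) mult_strict_right_mono[OF \<kappa> \<gamma>] by simp
  have "0 \<le> \<kappa> * \<gamma>" using \<eta> by linarith
  then have \<kappa>0: "0 \<le> \<kappa>" using \<gamma> by (simp add: zero_le_mult_iff)
  have \<kappa>2: "\<kappa>\<^sup>2 < 1" using \<kappa> \<kappa>0 by (simp add: power_less_one_iff)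
  have d2: "real d > 0" "(real d)\<^sup>2 > 0" using d by auto
  have m: "m = d * r" by (simp add: m_def J_def card_cartesian_product)
  have m1: "m \<ge> 1" using d r by (simp add: m)
  have finJ: "finite J" and finI: "finite I" and finX: "finite X"
    by (auto simp: J_def I_def X_def intro!: finite_PiE)
  have cardI: "card I = 128 ^ m" by (simp add: I_def m_def card_PiE finJ)
  have c: "c > 0" using h by (simp add: c_def)
  have c_le: "c * real k \<le> h" if "k < 128" for k
    using that h by (simp add: c_def field_simps)
  have abs_mean: "\<bar>truncated_mean \<eta> N \<theta> / \<gamma>\<bar> \<le> \<kappa>" for \<theta>
    using abs_truncated_mean_le[OF N \<eta>(1), of \<theta>] \<eta> \<gamma> by (simp add: divide_le_eq)
  have v: "\<bar>v\<bar> \<le> \<kappa>" unfolding v_def by (rule abs_mean)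
  have v2: "v\<^sup>2 \<le> \<kappa>\<^sup>2" using v \<kappa>0 by (metis abs_le_square_iff abs_of_nonneg)
  have sum_X: "(\<Sum>z\<in>X. g z) = (\<Sum>x\<in>matrix_units d. \<Sum>y\<in>{-1,1}. g (x, y))" for g :: "real mat \<times> real \<Rightarrow> real"
    by (simp add: X_def sum.cartesian_product')
  have sum_law: "(\<Sum>x\<in>matrix_units d. \<Sum>y\<in>{-1,1::real}. (1 + y * w x) / 2 / (real d)\<^sup>2) = 1" for w
  proof -
    have "(\<Sum>y\<in>{-1,1::real}. (1 + y * w x) / 2 / (real d)\<^sup>2) = 1 / (real d)\<^sup>2" for x
      by (simp add: add_divide_distrib[symmetric])
    then show ?thesis using d2 by (simp add: card_matrix_units)
  qed
  have p_sum: "(\<Sum>z\<in>X. p s z) = 1" for s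
    unfolding sum_X p_def prod.case by (rule sum_law)
  have q_sum: "(\<Sum>z\<in>X. q z) = 1"
    unfolding sum_X q_def prod.case by (rule sum_law)
  have q_pos: "q z > 0" if "z \<in> X" for z
    using that v \<kappa> d2 by (auto simp: X_def q_def)

  have chi: "(\<Sum>D\<in>?DS. (\<Prod>k<n. p s (D k))\<^sup>2 / (\<Prod>k<n. q (D k))) \<le> 2 ^ m" if s: "s \<in> I" for s
  proof -
    let ?e = "h\<^sup>2 / (\<gamma>\<^sup>2 * (1 - \<kappa>\<^sup>2))"
    have e0: "?e \<ge> 0" using \<kappa>2 by simp
    have "(\<Sum>z\<in>X. (p s z)\<^sup>2 / q z) \<le> (\<Sum>x\<in>matrix_units d. (1 + ?e) / (real d)\<^sup>2)"
      unfolding sum_X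
    proof (rule sum_mono)
      fix x assume "x \<in> matrix_units d"
      then obtain i j where ij: "i < d" "j < d" "x = matrix_unit d i j" by (auto simp: matrix_units_def)
      let ?u = "mean (tiled_mat d r c s) x"
      have "j mod r < r" using r by simp
      then have "s (i, j mod r) < 128" using s ij by (auto simp: I_def J_def)
      then have "\<bar>mat_inner x (tiled_mat d r c s)\<bar> \<le> h"
        using ij c c_le by (simp add: mat_inner_matrix_unit) (simp add: tiled_mat_def)
      then have "\<bar>truncated_mean \<eta> N (mat_inner x (tiled_mat d r c s)) - truncated_mean \<eta> N 0\<bar> \<le> h"
        using truncated_mean_lipschitz[OF N \<eta>(1), of "mat_inner x (tiled_mat d r c s)" 0] by simp
      then have "\<bar>?u - v\<bar> \<le> h / \<gamma>"
        unfolding mean_def v_def using \<gamma> by (simp add: diff_divide_distrib[symmetric] divide_right_mono)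
      then have "\<bar>?u - v\<bar>\<^sup>2 \<le> (h / \<gamma>)\<^sup>2" by (intro power_mono) auto
      \<comment> \<open>The reference variance \<open>1 - v\<^sup>2\<close> stays away from
        \<open>0\<close> because \<open>\<bar>v\<bar> \<le> \<kappa> < 1\<close>.\<close>
      then have "(?u - v)\<^sup>2 / (1 - v\<^sup>2) \<le> (h / \<gamma>)\<^sup>2 / (1 - \<kappa>\<^sup>2)"
        using v2 \<kappa>2 by (intro frac_le) auto
      then have e: "(?u - v)\<^sup>2 / (1 - v\<^sup>2) \<le> ?e" by (simp add: power_divide)
      have "(\<Sum>y\<in>{-1,1}. (p s (x, y))\<^sup>2 / q (x, y))
          = (\<Sum>y\<in>{-1,1}. ((1 + y * ?u) / 2)\<^sup>2 / ((1 + y * v) / 2) / (real d)\<^sup>2)"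
      proof (rule sum.cong[OF refl])
        fix y :: real
        have "(a / w)\<^sup>2 / (b / w) = a\<^sup>2 / b / w" if "w > 0" for a b w :: real
          using that by (simp add: power2_eq_square)
        from this[OF d2(2)] show "(p s (x, y))\<^sup>2 / q (x, y)
            = ((1 + y * ?u) / 2)\<^sup>2 / ((1 + y * v) / 2) / (real d)\<^sup>2"
          unfolding p_def q_def prod.case by blast
      qed
      also have "\<dots> = (1 + (?u - v)\<^sup>2 / (1 - v\<^sup>2)) / (real d)\<^sup>2"
        using v \<kappa> by (simp only: sum_divide_distrib[symmetric] sum_two_point_chi_square)
      also have "\<dots> \<le> (1 + ?e) / (real d)\<^sup>2"
        using e d2 by (intro divide_right_mono) auto
      finally show "(\<Sum>y\<in>{-1,1}. (p s (x, y))\<^sup>2 / q (x, y)) \<le> (1 + ?e) / (real d)\<^sup>2" .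
    qed
    also have "\<dots> = 1 + ?e" using d2 by (simp add: card_matrix_units)
    also have "\<dots> \<le> exp ?e" by (rule exp_ge_add_one_self)
    finally have "(\<Sum>z\<in>X. (p s z)\<^sup>2 / q z) ^ n \<le> exp ?e ^ n"
      using q_pos by (intro power_mono sum_nonneg divide_nonneg_pos) auto
    also have "\<dots> = exp (real n * ?e)" by (rule exp_of_nat_mult[symmetric])
    \<comment> \<open>The budget \<open>info\<close> enters here, with \<open>m = d * r\<close>;
      \<open>exp (1/2) \<le> 2\<close> then gives the base \<open>2\<close>.\<close>
    also have "\<dots> \<le> exp (real m * (1/2))"
    proof -
      have pos: "0 < \<gamma>\<^sup>2 * (1 - \<kappa>\<^sup>2)" using \<kappa>2 \<gamma> by simp
      have "real n * ?e = real n * h\<^sup>2 / (\<gamma>\<^sup>2 * (1 - \<kappa>\<^sup>2))" by simp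
      also have "\<dots> \<le> real m * (1/2)"
        using info unfolding pos_divide_le_eq[OF pos] by (simp add: m ac_simps)
      finally show ?thesis by simp
    qed
    also have "\<dots> = exp (1/2) ^ m" by (rule exp_of_nat_mult)
    also have "\<dots> \<le> 2 ^ m"
    proof (rule power_mono)
      have "(exp (1/2::real))\<^sup>2 = exp 1" by (simp add: power2_eq_square exp_add[symmetric])
      also have "\<dots> \<le> 2\<^sup>2" using exp_le by simp
      finally show "exp (1/2::real) \<le> 2" by (rule power2_le_imp_le) simp
    qed simp
    finally show ?thesis unfolding sum_PiE_chi_square[OF finX] .
  qed

  have fails_meas: "{\<sigma>\<in>space S. fails s D \<sigma>} \<in> sets S" "{\<sigma>\<in>space S. \<not> fails s D \<sigma>} \<in> sets S" for s D
  proof -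
    have [measurable]: "(\<lambda>\<sigma>. \<Sum>i<d. \<Sum>j<d. (A (map D [0..<n]) \<sigma> $$ (i, j) - tiled_mat d r c s $$ (i, j))\<^sup>2)
        \<in> borel_measurable S"
      by (intro borel_measurable_sum borel_measurable_power borel_measurable_diff A_meas) auto
    show "{\<sigma>\<in>space S. fails s D \<sigma>} \<in> sets S" "{\<sigma>\<in>space S. \<not> fails s D \<sigma>} \<in> sets S"
      unfolding fails_def frob_norm_minus_sq[OF tiled_mat_carrier] by measurable
  qed

  have small: "(\<Sum>s\<in>I. f s D) \<le> 4 ^ m" for D
  proof -
    have "(\<Sum>s\<in>I. f s D) = (\<Sum>s\<in>I. \<integral>\<sigma>. indicator {\<sigma>\<in>space S. \<not> fails s D \<sigma>} \<sigma> \<partial>S)"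
      using fails_meas by (simp add: f_def)
    \<comment> \<open>With sum and integral exchanged, the seed can be fixed, and the estimate
      becomes a single matrix \<open>T\<close> around which near tiled matrices are counted.\<close>
    also have "\<dots> = (\<integral>\<sigma>. (\<Sum>s\<in>I. indicator {\<sigma>\<in>space S. \<not> fails s D \<sigma>} \<sigma>) \<partial>S)"
      using fails_meas by (intro Bochner_Integration.integral_sum[symmetric]) (auto simp: S.emeasure_eq_measure)
    also have "\<dots> \<le> (\<integral>\<sigma>. 4 ^ m \<partial>S)"
    proof (rule integral_mono)
      show "integrable S (\<lambda>\<sigma>. \<Sum>s\<in>I. indicator {\<sigma>\<in>space S. \<not> fails s D \<sigma>} \<sigma> :: real)"
        using fails_meas by (intro Bochner_Integration.integrable_sum) (auto simp: S.emeasure_eq_measure)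
      fix \<sigma> assume \<sigma>: "\<sigma> \<in> space S"
      define T where "T = A (map D [0..<n]) \<sigma>"
      \<comment> \<open>The number of complete tiles. Since \<open>r \<le> d\<close>, it is at least
        \<open>1\<close>, so \<open>d < (g + 1) * r \<le> 2 * (g * r)\<close>.\<close>
      define g where "g = d div r"
      have g: "g > 0" "g * r \<le> d" using r by (auto simp: g_def div_greater_zero_iff)
      have "d = g * r + d mod r" by (simp add: g_def)
      moreover have "d mod r < r" using r by simp
      moreover have "r \<le> g * r" using g(1) by simp
      ultimately have "d \<le> 2 * (g * r)" by linarith
      then have "real d \<le> real (2 * (g * r))" by (rule of_nat_mono)
      then have dg: "real d \<le> 2 * (real g * real r)" by simp
      have close: "(\<Sum>j\<in>J. (real (s j) - tile_average g r c T j)\<^sup>2) \<le> real (card J) / 28"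
        if "\<not> fails s D \<sigma>" for s
      proof -
        let ?E = "\<Sum>j\<in>J. (real (s j) - tile_average g r c T j)\<^sup>2"
        have "c\<^sup>2 * real g * ?E \<le> (frob_norm (T - tiled_mat d r c s))\<^sup>2"
          unfolding J_def by (rule frob_norm_tiled_ge[OF c g])
        also have "\<dots> \<le> h\<^sup>2 / (56 * 128\<^sup>2) * (real d)\<^sup>2"
          using that d2 by (simp add: fails_def T_def divide_less_eq not_le)
        also have "\<dots> = c\<^sup>2 * (real d * real d / 56)"
          by (simp add: c_def power_divide power2_eq_square)
        finally have "real g * ?E \<le> real d * real d / 56"
          using c by (simp add: mult.assoc)
        also have "\<dots> \<le> real d * (2 * (real g * real r)) / 56"
          using dg by (intro divide_right_mono mult_left_mono) auto
        also have "\<dots> = real g * (real (card J) / 28)"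
          by (simp add: m_def[symmetric] m)
        finally show ?thesis using g(1) by simp
      qed
      have "(\<Sum>s\<in>I. indicator {\<sigma>\<in>space S. \<not> fails s D \<sigma>} \<sigma> :: real) = real (card {s\<in>I. \<not> fails s D \<sigma>})"
        using \<sigma> finI by (simp add: indicator_def sum.If_cases Int_def)
      also have "card {s\<in>I. \<not> fails s D \<sigma>} \<le> card {s\<in>I. (\<Sum>j\<in>J. (real (s j) - tile_average g r c T j)\<^sup>2) \<le> real (card J) / 28}"
        using close finI by (intro card_mono) auto
      also have "\<dots> \<le> 4 ^ m" unfolding I_def m_def by (rule card_near_levels_le[OF finJ])
      finally show "(\<Sum>s\<in>I. indicator {\<sigma>\<in>space S. \<not> fails s D \<sigma>} \<sigma>) \<le> (4 ^ m :: real)"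
        by simp
    qed simp
    finally show ?thesis by (simp add: S.prob_space)
  qed

  \<comment> \<open>The weight \<open>B = 8 ^ m\<close> balances the two terms:
    \<open>8 * 4 = 32\<close> and \<open>128 * 2 / 8 = 32\<close>.\<close>
  have avg: "(\<Sum>s\<in>I. \<Sum>D\<in>?DS. (\<Prod>k<n. p s (D k)) * f s D)
      \<le> (8 ^ m * 4 ^ m + real (card I) * 2 ^ m / 8 ^ m) / 2"
  proof (rule sum_success_le)
    show "(\<Prod>k<n. q (D k)) > 0" if "D \<in> ?DS" for D
      using that by (intro prod_pos) (auto intro!: q_pos)
    show "(\<Sum>D\<in>?DS. \<Prod>k<n. q (D k)) = 1" by (rule sum_PiE_prod_eq_1[OF finX q_sum])
  qed (use chi small in \<open>auto simp: f_def\<close>)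
  also have "\<dots> = 32 ^ m"
  proof -
    have "(8::real) ^ m * 4 ^ m = 32 ^ m" by (simp flip: power_mult_distrib)
    moreover have "(128::real) ^ m * 2 ^ m / 8 ^ m = 32 ^ m"
      by (simp flip: power_mult_distrib power_divide)
    ultimately show ?thesis by (simp add: cardI)
  qed
  \<comment> \<open>The average success probability is at most \<open>(32 / 128) ^ m\<close>, which
    is at most \<open>1/4\<close> already for \<open>m = 1\<close>.\<close>
  also have "\<dots> \<le> real (card I) * (1/4)"
  proof -
    have "(4::real) ^ 1 \<le> 4 ^ m" using m1 by (intro power_increasing) auto
    moreover have "(128::real) ^ m = 32 ^ m * 4 ^ m" by (simp flip: power_mult_distrib)
    ultimately show ?thesis by (simp add: cardI)
  qed
  finally have avg': "(\<Sum>s\<in>I. \<Sum>D\<in>?DS. (\<Prod>k<n. p s (D k)) * f s D) \<le> (\<Sum>s\<in>I. 1/4)" by simp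
  have "\<exists>s\<in>I. (\<Sum>D\<in>?DS. (\<Prod>k<n. p s (D k)) * f s D) \<le> 1/4"
  proof (rule ccontr)
    assume "\<not> ?thesis"
    moreover have "I \<noteq> {}" using cardI by auto
    ultimately have "(\<Sum>s\<in>I. 1/4) < (\<Sum>s\<in>I. \<Sum>D\<in>?DS. (\<Prod>k<n. p s (D k)) * f s D)"
      using finI by (intro sum_strict_mono) (auto simp: not_le)
    then show False using avg' by simp
  qed
  then obtain s where s: "s \<in> I" "(\<Sum>D\<in>?DS. (\<Prod>k<n. p s (D k)) * f s D) \<le> 1/4" by blast
  let ?\<Theta> = "tiled_mat d r c s"
  have mem: "?\<Theta> \<in> low_rank_class d r \<alpha>"
  proof (rule tiled_mat_in_low_rank_class)
    fix i j assume "i < d" "j < r"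
    then have "s (i, j) < 128" using s(1) by (auto simp: I_def J_def)
    then show "c * real (s (i, j)) \<le> \<alpha>" using c_le h(2) by force
  qed (use d r c in auto)

  let ?obs = "\<lambda>z. (fst z, one_bit_obs \<eta> ?\<Theta> z)"
  interpret N: prob_space N by fact
  interpret U: prob_space "uniform_measure lborel {-\<gamma>..\<gamma>}"
    using \<gamma> by (intro prob_space_uniform_measure) auto
  interpret NU: pair_prob_space N "uniform_measure lborel {-\<gamma>..\<gamma>}" by unfold_locales
  have "matrix_units d \<noteq> {}" using d by (auto simp: matrix_units_eq_image lessThan_empty_iff)
  then interpret C: prob_space "uniform_count_measure (matrix_units d)"
    by (intro prob_space_uniform_count_measure) auto
  interpret L: pair_prob_space "uniform_count_measure (matrix_units d)"
      "N \<Otimes>\<^sub>M uniform_measure lborel {-\<gamma>..\<gamma>}" by unfold_locales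
  have obs_law: "{z\<in>space ?L. ?obs z = x} \<in> sets ?L" "measure ?L {z\<in>space ?L. ?obs z = x} = p s x"
    if "x \<in> X" for x
    using that prob_observation[OF N \<eta>(1) \<eta>\<gamma>, of "fst x" d "snd x" ?\<Theta>]
    by (auto simp: X_def p_def mean_def)
  have event: "(frob_norm (A (observed_data n \<eta> ?\<Theta> \<omega>) \<sigma> - ?\<Theta>))\<^sup>2 / (real d)\<^sup>2 \<ge> h\<^sup>2 / (56 * 128\<^sup>2)
      \<longleftrightarrow> fails s (\<lambda>k\<in>{..<n}. ?obs (\<omega> k)) \<sigma>" for \<omega> \<sigma>
  proof -
    have "map (\<lambda>k\<in>{..<n}. ?obs (\<omega> k)) [0..<n] = observed_data n \<eta> ?\<Theta> \<omega>"
      unfolding observed_data_def by (rule map_cong) auto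
    then show ?thesis by (simp add: fails_def)
  qed
  have "measure (sampling_law n d N \<gamma> \<Otimes>\<^sub>M S)
       {(\<omega>, \<sigma>) \<in> space (sampling_law n d N \<gamma> \<Otimes>\<^sub>M S).
          (frob_norm (A (observed_data n \<eta> ?\<Theta> \<omega>) \<sigma> - ?\<Theta>))\<^sup>2 / (real d)\<^sup>2 \<ge> h\<^sup>2 / (56 * 128\<^sup>2)}
     = measure ((\<Pi>\<^sub>M k\<in>{..<n}. ?L) \<Otimes>\<^sub>M S)
       {(\<omega>, \<sigma>) \<in> space ((\<Pi>\<^sub>M k\<in>{..<n}. ?L) \<Otimes>\<^sub>M S).
          \<sigma> \<in> {\<sigma>\<in>space S. fails s (\<lambda>k\<in>{..<n}. ?obs (\<omega> k)) \<sigma>}}"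
    unfolding sampling_law_def event
    by (intro arg_cong[where f="measure _"]) (auto simp: space_pair_measure)
  also have "\<dots> = (\<Sum>D\<in>?DS. (\<Prod>k<n. measure ?L {z\<in>space ?L. ?obs z = D k})
      * measure S {\<sigma>\<in>space S. fails s D \<sigma>})"
  proof (rule measure_observations_pair[OF L.prob_space_axioms S.prob_space_axioms finX])
    fix z assume "z \<in> space ?L"
    then show "?obs z \<in> X"
      by (auto simp: X_def space_pair_measure space_uniform_count_measure one_bit_obs_def sign1_def)
  qed (use obs_law fails_meas in auto)
  \<comment> \<open>Passing to the complement: given \<open>D\<close>, failure has probability
    \<open>1 - f s D\<close>, and the data laws sum to \<open>1\<close>.\<close>
  also have "\<dots> = (\<Sum>D\<in>?DS. (\<Prod>k<n. p s (D k)) - (\<Prod>k<n. p s (D k)) * f s D)"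
  proof (rule sum.cong[OF refl])
    fix D assume D: "D \<in> ?DS"
    have P: "(\<Prod>k<n. measure ?L {z\<in>space ?L. ?obs z = D k}) = (\<Prod>k<n. p s (D k))"
      using D by (intro prod.cong) (auto intro!: obs_law(2))
    have F: "measure S {\<sigma>\<in>space S. fails s D \<sigma>} = 1 - f s D"
      using fails_meas
      by (simp add: f_def S.prob_neg)
    show "(\<Prod>k<n. measure ?L {z\<in>space ?L. ?obs z = D k}) * measure S {\<sigma>\<in>space S. fails s D \<sigma>}
        = (\<Prod>k<n. p s (D k)) - (\<Prod>k<n. p s (D k)) * f s D"
      unfolding P F by (simp add: right_diff_distrib)
  qed
  also have "\<dots> = 1 - (\<Sum>D\<in>?DS. (\<Prod>k<n. p s (D k)) * f s D)"
    by (simp add: sum_subtractf sum_PiE_prod_eq_1[OF finX p_sum])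
  also have "\<dots> \<ge> 3/4" using s(2) by simp
  finally show ?thesis using mem by blast
qed

text \<open>Verifies the budget \<open>info\<close> for the rate in the theorem. Squaring
  \<open>\<gamma>\<close> turns the fourth root into the square root of
  \<open>z = n / (\<delta> d log d)\<close>, and \<open>n * sqrt (d / (n log d))\<close> equals
  \<open>sqrt \<delta> * d * sqrt z\<close>, so both sides carry the factor
  \<open>d * sqrt z\<close>.\<close>

lemma sample_size_bound:
  fixes \<delta> C \<kappa> \<alpha> M \<gamma> :: real
  assumes "\<delta> > 0" "\<kappa>\<^sup>2 \<le> 1" "d \<ge> 2" "\<alpha> \<ge> 0" "M \<ge> 0" "n > 0"
    and \<gamma>: "\<gamma> = C * max \<alpha> (sqrt M) * (real n / (\<delta> * real d * ln (real d))) powr (1/4)"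
  shows "real n * ((1 - \<kappa>\<^sup>2) * C\<^sup>2 / (4 * sqrt \<delta>) * (\<alpha>\<^sup>2 + M) * real r * sqrt (real d / (real n * ln (real d))))
    \<le> \<gamma>\<^sup>2 * (1 - \<kappa>\<^sup>2) * (real r * real d / 2)"
proof -
  define L where "L = ln (real d)"
  define mx where "mx = max \<alpha> (sqrt M)"
  have L: "L > 0" using assms by (simp add: L_def)
  define z where "z = real n / (\<delta> * real d * L)"
  have z: "z > 0" using assms L by (simp add: z_def)
  have "(z powr (1/4))\<^sup>2 = sqrt z"
    using z by (simp add: powr_half_sqrt[symmetric] powr_power)
  then have g2: "\<gamma>\<^sup>2 = C\<^sup>2 * mx\<^sup>2 * sqrt z"
    unfolding \<gamma> L_def[symmetric] z_def[symmetric] mx_def[symmetric] by (simp add: power_mult_distrib)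
  have "\<alpha>\<^sup>2 + M \<le> 2 * mx\<^sup>2"
  proof -
    have "\<alpha>\<^sup>2 \<le> mx\<^sup>2" if "\<alpha> \<ge> 0" using that by (intro power_mono) (auto simp: mx_def)
    moreover have "(sqrt M)\<^sup>2 \<le> mx\<^sup>2" using assms by (intro power_mono) (auto simp: mx_def)
    ultimately show ?thesis using assms by simp
  qed
  have rate: "real n * sqrt (real d / (real n * L)) = sqrt \<delta> * (real d * sqrt z)"
  proof -
    have "real n * sqrt (real d / (real n * L)) = sqrt ((real n)\<^sup>2 * (real d / (real n * L)))"
      by (subst real_sqrt_mult) simp
    also have "(real n)\<^sup>2 * (real d / (real n * L)) = \<delta> * ((real d)\<^sup>2 * z)"
      using assms L by (simp add: z_def field_simps power2_eq_square)
    also have "sqrt \<dots> = sqrt \<delta> * (real d * sqrt z)"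
      by (simp add: real_sqrt_mult)
    finally show ?thesis .
  qed
  have "real n * ((1 - \<kappa>\<^sup>2) * C\<^sup>2 / (4 * sqrt \<delta>) * (\<alpha>\<^sup>2 + M) * real r * sqrt (real d / (real n * L)))
      = (1 - \<kappa>\<^sup>2) * C\<^sup>2 / (4 * sqrt \<delta>) * (\<alpha>\<^sup>2 + M) * real r * (real n * sqrt (real d / (real n * L)))"
    by simp
  also have "\<dots> = (1 - \<kappa>\<^sup>2) * C\<^sup>2 / 4 * real r * (real d * sqrt z) * (\<alpha>\<^sup>2 + M)"
    unfolding rate using assms by simp
  also have "\<dots> \<le> (1 - \<kappa>\<^sup>2) * C\<^sup>2 / 4 * real r * (real d * sqrt z) * (2 * mx\<^sup>2)"
    using \<open>\<alpha>\<^sup>2 + M \<le> 2 * mx\<^sup>2\<close> assms z by (intro mult_left_mono) auto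
  also have "\<dots> = \<gamma>\<^sup>2 * (1 - \<kappa>\<^sup>2) * (real r * real d / 2)"
    unfolding g2 by simp
  finally show ?thesis unfolding L_def .
qed

theorem theorem14:
  fixes \<delta> C15 C16 :: real
  assumes "\<delta> > 1" and "C16 > C15"
  shows "\<exists>D1 > 0. \<exists>D2 > 0.
    \<forall>(n::nat) (d::nat) (r::nat) (\<alpha>::real) (M::real) (\<eta>::real) (\<gamma>::real)
     (N::real measure) (S::real measure) (A::(real mat \<times> real) list \<Rightarrow> real \<Rightarrow> real mat).
      d \<ge> 2 \<longrightarrow> 1 \<le> r \<longrightarrow> r \<le> d \<longrightarrow> \<alpha> > 0 \<longrightarrow> noise_law M N \<longrightarrow>
      \<eta> = C15 * max \<alpha> (sqrt M) * (real n / (\<delta> * real d * ln (real d))) powr (1/4) \<longrightarrow>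
      \<gamma> = C16 * max \<alpha> (sqrt M) * (real n / (\<delta> * real d * ln (real d))) powr (1/4) \<longrightarrow>
      \<gamma> > 2 * max \<alpha> (sqrt M) \<longrightarrow> \<gamma> > \<eta> \<longrightarrow> \<eta> > \<alpha> \<longrightarrow>
      estimator d S A \<longrightarrow>
      (\<exists>\<Theta>0 \<in> low_rank_class d r \<alpha>.
         measure (sampling_law n d N \<gamma> \<Otimes>\<^sub>M S)
           {(\<omega>, s) \<in> space (sampling_law n d N \<gamma> \<Otimes>\<^sub>M S).
              (frob_norm (A (observed_data n \<eta> \<Theta>0 \<omega>) s - \<Theta>0))\<^sup>2 / (real d)\<^sup>2
              \<ge> min (D1 * \<alpha>\<^sup>2)
                    (D2 * (\<alpha>\<^sup>2 + M) * real r * sqrt (real d / (real n * ln (real d))))} \<ge> 3/4)"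
proof (cases "C15 > 0")
  case False
  \<comment> \<open>For \<open>C15 \<le> 0\<close> the formula gives \<open>\<eta> \<le> 0\<close>,
    contradicting \<open>\<eta> > \<alpha> > 0\<close>, so any constants will do.\<close>
  have vacuous: "\<not> \<alpha> < C15 * max \<alpha> (sqrt M) * z powr (1/4)" if "\<alpha> > 0" for \<alpha> M z :: real
  proof -
    have "C15 * max \<alpha> (sqrt M) * z powr (1/4) \<le> 0"
      using False that by (intro mult_nonpos_nonneg) auto
    then show ?thesis using that by simp
  qed
  have pos: "(1::real) > 0" by simp
  show ?thesis
    by (rule exI[of _ 1], rule conjI[OF pos], rule exI[of _ 1], rule conjI[OF pos]) (use vacuous in blast)
next
  case True
  define \<kappa> where "\<kappa> = C15 / C16"
  \<comment> \<open>\<open>D1\<close> is the factor in the threshold of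
    \<open>minimax_lower_bound\<close> and \<open>c0\<close> the one in
    \<open>sample_size_bound\<close> at \<open>C = C16\<close>; their product serves as
    \<open>D2\<close>.\<close>
  define D1 :: real where "D1 = 1 / (56 * 128\<^sup>2)"
  define c0 where "c0 = (1 - \<kappa>\<^sup>2) * C16\<^sup>2 / (4 * sqrt \<delta>)"
  have C16: "C16 > 0" using True assms by simp
  have \<kappa>: "0 < \<kappa>" "\<kappa> < 1" using True C16 assms by (auto simp: \<kappa>_def)
  have \<kappa>2: "\<kappa>\<^sup>2 < 1" using \<kappa> by (simp add: power_less_one_iff)
  have D1: "D1 > 0" by (simp add: D1_def)
  have c0: "c0 > 0" using \<kappa>2 C16 assms by (simp add: c0_def)
  show ?thesis
  proof (rule exI[of _ D1], rule conjI[OF D1], rule exI[of _ "D1 * c0"], intro conjI allI impI)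
    show "D1 * c0 > 0" using D1 c0 by simp
    fix n d r :: nat and \<alpha> M \<eta> \<gamma> :: real and N S :: "real measure"
      and A :: "(real mat \<times> real) list \<Rightarrow> real \<Rightarrow> real mat"
    assume d: "d \<ge> 2" and r: "1 \<le> r" "r \<le> d" and \<alpha>: "\<alpha> > 0" and N: "noise_law M N"
      and \<eta>: "\<eta> = C15 * max \<alpha> (sqrt M) * (real n / (\<delta> * real d * ln (real d))) powr (1/4)"
      and \<gamma>: "\<gamma> = C16 * max \<alpha> (sqrt M) * (real n / (\<delta> * real d * ln (real d))) powr (1/4)"
      and \<gamma>2: "\<gamma> > 2 * max \<alpha> (sqrt M)" and "\<gamma> > \<eta>" and \<eta>\<alpha>: "\<eta> > \<alpha>" and A: "estimator d S A"
    have N': "prob_space N" "sets N = sets borel" using N by (auto simp: noise_law_def)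
    have "0 \<le> (\<integral>x. x\<^sup>2 \<partial>N)" by simp
    then have M: "M \<ge> 0" using N unfolding noise_law_def by linarith
    have \<gamma>0: "\<gamma> > 0" using \<open>\<gamma> > \<eta>\<close> \<eta>\<alpha> \<alpha> by simp
    \<comment> \<open>For \<open>n = 0\<close> the power is \<open>0 powr (1/4) = 0\<close>, which
      would force \<open>\<gamma> = 0\<close>.\<close>
    have n: "n > 0"
    proof (rule ccontr)
      assume "\<not> n > 0"
      then show False using \<gamma> \<gamma>0 by simp
    qed
    have \<eta>\<kappa>: "\<eta> = \<kappa> * \<gamma>" using C16 unfolding \<eta> \<gamma> \<kappa>_def by simp
    define R where "R = c0 * (\<alpha>\<^sup>2 + M) * real r * sqrt (real d / (real n * ln (real d)))"
    have R: "R > 0" using c0 \<alpha> M r d n by (auto simp: R_def intro!: mult_pos_pos add_pos_nonneg)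
    \<comment> \<open>The cap \<open>\<alpha>\<^sup>2\<close> keeps the entries in range, and
      \<open>R\<close> is the largest size that \<open>sample_size_bound\<close> covers; the two
      produce the two terms of the minimum.\<close>
    define h where "h = sqrt (min (\<alpha>\<^sup>2) R)"
    have h2: "h\<^sup>2 = min (\<alpha>\<^sup>2) R" using R by (simp add: h_def)
    have h: "h > 0" "h \<le> \<alpha>" using R \<alpha> by (auto simp: h_def intro!: real_le_lsqrt)
    have "real n * h\<^sup>2 \<le> real n * R" unfolding h2 by (intro mult_left_mono) auto
    also have "\<dots> \<le> \<gamma>\<^sup>2 * (1 - \<kappa>\<^sup>2) * (real r * real d / 2)"
      unfolding R_def c0_def using assms \<kappa>2 d \<alpha> M n by (intro sample_size_bound[OF _ _ _ _ _ _ \<gamma>]) auto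
    finally have info: "real n * h\<^sup>2 \<le> \<gamma>\<^sup>2 * (1 - \<kappa>\<^sup>2) * (real r * real d / 2)" .
    have thr: "min (D1 * \<alpha>\<^sup>2) (D1 * c0 * (\<alpha>\<^sup>2 + M) * real r * sqrt (real d / (real n * ln (real d))))
        = h\<^sup>2 / (56 * 128\<^sup>2)"
    proof -
      have "D1 * c0 * (\<alpha>\<^sup>2 + M) * real r * sqrt (real d / (real n * ln (real d))) = D1 * R"
        by (simp add: R_def mult.assoc)
      moreover have "min (D1 * \<alpha>\<^sup>2) (D1 * R) = D1 * h\<^sup>2"
        unfolding h2 using D1 by (simp add: min_mult_distrib_left)
      ultimately show ?thesis by (simp add: D1_def)
    qed
    show "\<exists>\<Theta>0 \<in> low_rank_class d r \<alpha>.
         measure (sampling_law n d N \<gamma> \<Otimes>\<^sub>M S)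
           {(\<omega>, s) \<in> space (sampling_law n d N \<gamma> \<Otimes>\<^sub>M S).
              (frob_norm (A (observed_data n \<eta> \<Theta>0 \<omega>) s - \<Theta>0))\<^sup>2 / (real d)\<^sup>2
              \<ge> min (D1 * \<alpha>\<^sup>2)
                    (D1 * c0 * (\<alpha>\<^sup>2 + M) * real r * sqrt (real d / (real n * ln (real d))))} \<ge> 3/4"
      unfolding thr
      using minimax_lower_bound[OF d r N' _ _ \<kappa>(2) \<gamma>0 h info A] \<eta>\<kappa> \<eta>\<alpha> \<alpha> by simp
  qed
qed

end
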